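(* Let $1\le p\le\infty$, let $R>0$, and let $F:\mathbb{R}^2\to\mathbb{R}$ be in $L^p$ and supported in the disc $\mathbb{B}_R\subset\mathbb{R}^2$ of radius $R$ centered at the origin. Suppose $0\le\delta<\pi$, and define $$F_\delta(x,y)=F(x\cos(\delta)+y\sin(\delta),\ y\cos(\delta)-x\sin(\delta)).$$ Then for any probability distribution $\eta$ over the unit circle $\mathbb{S}^1$, $$\mathrm{SV}_{p,\eta}(F,F_\delta)\le(2\sin(\delta/2))^{1/p}\cdot\min\left\{\delta^{1-1/p}\cdot\|F\|_{L^p}\cdot R^{2-1/p},\ \|F\|_{L^1}\cdot R^{1/p}\right\}.$$
   Context: For $p=\infty$, $1/p=0$. Tomographic projection onto the line spanned by a unit vector $w\in\mathbb{S}^1$: with $w^\perp$ a unit vector orthogonal to $w$, $(\mathcal{P}_wF)(t)=\int_{\mathbb{R}}F(tw+sw^\perp)\,ds$. Volterra $p$-norm: for an integrable function $h$ of one variable supported in $[a,b]$, $(\mathcal{V}h)(x)=\int_a^xh(t)\,dt$ and $\|h\|_{V^p}=\|\mathcal{V}h\|_{L^p([a,b])}$; here one may take $[a,b]=[-R,R]$. Sliced Volterra distance: $$\mathrm{SV}_{p,\eta}(f,g)=\left(\int_{\mathbb{S}^{1}}\|\mathcal{P}_wf-\mathcal{P}_wg\|_{V^p}^p\,d\eta(w)\right)^{1/p},$$ interpreted for $p=\infty$ as the $\eta$-essential supremum of $\|\mathcal{P}_wf-\mathcal{P}_wg\|_{V^\infty}$ over $w\in\mathbb{S}^1$. *)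

theory Defs
  imports "HOL-Probability.Probability"
begin

text \<open>
  Norms are valued in \<^typ>\<open>ennreal\<close>, so that no inequality can hold merely because a
  divergent integral was totalised to \<open>0\<close>.  The exponent \<open>p\<close> ranges over \<^typ>\<open>ennreal\<close> too; since
  \<^prop>\<open>inverse (\<infinity>::ennreal) = 0\<close>, \<open>recip p\<close> is \<open>1/p\<close> with the convention \<open>1/\<infinity> = 0\<close>.
\<close>

definition recip :: "ennreal \<Rightarrow> real" where
  "recip p = enn2real (inverse p)"

text \<open>Power of an extended nonnegative real; intended for exponents \<open>r > 0\<close> only.\<close>

definition epowr :: "ennreal \<Rightarrow> real \<Rightarrow> ennreal" where
  "epowr x r = (if x = \<infinity> then \<infinity> else ennreal (enn2real x powr r))"

definition eLp_norm :: "ennreal \<Rightarrow> 'a measure \<Rightarrow> ('a \<Rightarrow> ennreal) \<Rightarrow> ennreal" where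
  "eLp_norm p M g =
     (if p = \<infinity> then esssup M g
      else epowr (\<integral>\<^sup>+ x. epowr (g x) (enn2real p) \<partial>M) (1 / enn2real p))"

definition Lp_norm :: "ennreal \<Rightarrow> 'a measure \<Rightarrow> ('a \<Rightarrow> real) \<Rightarrow> ennreal" where
  "Lp_norm p M f = eLp_norm p M (\<lambda>x. ennreal \<bar>f x\<bar>)"

definition in_Lp :: "ennreal \<Rightarrow> 'a measure \<Rightarrow> ('a \<Rightarrow> real) \<Rightarrow> bool" where
  "in_Lp p M f \<longleftrightarrow> f \<in> borel_measurable M \<and> Lp_norm p M f < \<infinity>"

text \<open>The plane is \<^typ>\<open>real \<times> real\<close>, whose library norm is the Euclidean one.\<close>

definition perp :: "real \<times> real \<Rightarrow> real \<times> real" where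
  "perp w = (- snd w, fst w)"

text \<open>
  The other unit normal \<open>- perp w\<close> gives the same projection, by the substitution
  \<open>s \<mapsto> - s\<close>.  Integration is against the completed measure \<open>lebesgue\<close>, because slices of a
  Lebesgue measurable function are in general (almost all) only Lebesgue measurable.
\<close>

definition proj :: "real \<times> real \<Rightarrow> (real \<times> real \<Rightarrow> real) \<Rightarrow> real \<Rightarrow> real" where
  "proj w F t = (LINT s|lebesgue. F (t *\<^sub>R w + s *\<^sub>R perp w))"

definition volterra :: "real \<Rightarrow> (real \<Rightarrow> real) \<Rightarrow> real \<Rightarrow> real" where
  "volterra a h x = (LINT t:{a..x}|lebesgue. h t)"

definition volterra_norm :: "ennreal \<Rightarrow> real \<Rightarrow> real \<Rightarrow> (real \<Rightarrow> real) \<Rightarrow> ennreal" where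
  "volterra_norm p a b h = Lp_norm p (lebesgue_on {a..b}) (volterra a h)"

text \<open>
  The parameter \<open>R\<close> fixes the interval \<open>[-R, R]\<close> of the Volterra norm.  For \<open>p < \<infinity>\<close>,
  \<^const>\<open>eLp_norm\<close> unfolds to \<open>(\<integral> \<parallel>\<dots>\<parallel>\<^sup>p d\<eta>)\<close> to the power \<open>1/p\<close>; for
  \<open>p = \<infinity>\<close> it is the \<open>\<eta>\<close>-essential supremum.
\<close>

definition sliced_volterra ::
  "ennreal \<Rightarrow> (real \<times> real) measure \<Rightarrow> real
     \<Rightarrow> (real \<times> real \<Rightarrow> real) \<Rightarrow> (real \<times> real \<Rightarrow> real) \<Rightarrow> ennreal" where
  "sliced_volterra p \<eta> R f g =
     eLp_norm p \<eta> (\<lambda>w. volterra_norm p (- R) R (\<lambda>t. proj w f t - proj w g t))"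

definition rotated :: "real \<Rightarrow> (real \<times> real \<Rightarrow> real) \<Rightarrow> real \<times> real \<Rightarrow> real" where
  "rotated \<delta> F = (\<lambda>(x, y). F (x * cos \<delta> + y * sin \<delta>, y * cos \<delta> - x * sin \<delta>))"

end

theory Submission
  imports Defs "HOL-Real_Asymp.Real_Asymp"
begin

text \<open>
  Rotating \<open>F\<close> by \<open>\<delta>\<close> has the same effect on projections as rotating the direction \<open>w\<close> to a unit vector
  \<open>w'\<close> at angle \<open>\<delta>\<close> (\<open>proj_rotated\<close>).  By Fubini the Volterra primitive of \<open>\<P>\<^sub>w F\<close> at \<open>x\<close> is the integral of
  \<open>F\<close> over the half-plane \<open>u \<bullet> w \<le> x\<close> (\<open>volterra_proj\<close>).  The difference \<open>V x\<close> of the two primitives is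
  therefore bounded by the mass of \<open>\<bar>F\<bar>\<close> on the double wedge \<open>D\<^sub>x\<close>, the part of the disc where the
  half-planes \<open>u \<bullet> w \<le> x\<close> and \<open>u \<bullet> w' \<le> x\<close> disagree.  Two facts about these wedges carry the proof.

  Their area is at most \<open>\<delta> R\<^sup>2\<close>, for every \<open>x\<close> (\<open>emeasure_wedge_le\<close>).  Slicing along \<open>w\<close> shows that turning
  by a small angle \<open>\<epsilon>\<close> sweeps at most \<open>\<epsilon> R\<^sup>2 + O(\<epsilon>\<^sup>2)\<close>, and the symmetric difference is subadditive, so
  the angle \<open>\<delta>\<close> can be traversed in many small steps.

  As \<open>x\<close> varies, a point \<open>u\<close> of the disc lies in \<open>D\<^sub>x\<close> only for the \<open>x\<close> between \<open>u \<bullet> w\<close> and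
  \<open>u \<bullet> w'\<close>, an interval of length at most \<open>\<parallel>u\<parallel> \<parallel>w - w'\<parallel> \<le> 2 R sin (\<delta>/2)\<close>
  (\<open>nn_integral_wedge_offsets_le\<close>).

  For finite \<open>p\<close>, Hoelder's inequality on \<open>D\<^sub>x\<close> bounds \<open>\<bar>V x\<bar>\<^bsup>p\<^esup>\<close> by \<open>(\<delta> R\<^sup>2)\<^bsup>p-1\<^esup>\<close> times the mass of
  \<open>\<bar>F\<bar>\<^bsup>p\<^esup>\<close> on \<open>D\<^sub>x\<close>, and \<open>\<bar>V x\<bar> \<le> \<parallel>F\<parallel>\<^sub>1\<close> bounds it by \<open>\<parallel>F\<parallel>\<^sub>1\<^bsup>p-1\<^esup>\<close> times the mass of \<open>\<bar>F\<bar>\<close>.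
  Integrating over \<open>x\<close> and taking \<open>p\<close>-th roots gives the two members of the minimum.  For \<open>p = \<infinity>\<close> they are
  the pointwise bounds on \<open>V\<close>.  All this holds for each single direction, so averaging over a probability
  measure \<open>\<eta>\<close> does not change the bound.
\<close>

section \<open>Rotation invariance of plane Lebesgue measure\<close>

text \<open>
  By Tonelli a shear acts on each horizontal line as a translation.
\<close>

lemma distr_lborel_shear_fst:
  "distr lborel lborel (\<lambda>u. (fst u + k * snd u, snd u)) = (lborel :: (real \<times> real) measure)"
    (is "distr _ _ ?f = _")
proof (rule measure_eqI)
  fix A :: "(real \<times> real) set"
  assume "A \<in> sets (distr lborel lborel ?f)"
  then have [measurable]: "A \<in> sets (borel \<Otimes>\<^sub>M borel)" by (simp add: borel_prod[symmetric])
  have f [measurable]: "?f \<in> borel \<Otimes>\<^sub>M borel \<rightarrow>\<^sub>M borel \<Otimes>\<^sub>M borel" by measurable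
  have "emeasure (distr lborel lborel ?f) A = (\<integral>\<^sup>+ u. indicator A u \<partial>distr lborel lborel ?f)"
    by (simp add: borel_prod[symmetric])
  also have "\<dots> = (\<integral>\<^sup>+ u. indicator A (?f u) \<partial>(lborel \<Otimes>\<^sub>M lborel))"
    unfolding lborel_prod using f by (subst nn_integral_distr) (simp_all add: borel_prod[symmetric])
  also have "\<dots> = (\<integral>\<^sup>+ y. \<integral>\<^sup>+ x. indicator A (x + k * y, y) \<partial>lborel \<partial>lborel)"
    by (subst lborel_pair.nn_integral_snd[symmetric]) (simp_all add: split_beta')
  also have "\<dots> = (\<integral>\<^sup>+ y. \<integral>\<^sup>+ x. indicator A (x, y) \<partial>lborel \<partial>lborel)"
  proof (rule nn_integral_cong)
    fix y :: real
    show "(\<integral>\<^sup>+ x. indicator A (x + k * y, y) \<partial>lborel) = (\<integral>\<^sup>+ x. indicator A (x, y) \<partial>lborel)"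
      by (subst (2) nn_integral_real_affine[where c=1 and t="k * y"]) (simp_all add: add.commute)
  qed
  also have "\<dots> = (\<integral>\<^sup>+ u. indicator A u \<partial>(lborel \<Otimes>\<^sub>M lborel))"
    by (subst lborel_pair.nn_integral_snd[symmetric]) simp_all
  also have "\<dots> = emeasure lborel A"
    unfolding lborel_prod by (simp add: borel_prod[symmetric])
  finally show "emeasure (distr lborel lborel ?f) A = emeasure lborel A" .
qed simp

lemma distr_lborel_shear_snd:
  "distr lborel lborel (\<lambda>u. (fst u, snd u + k * fst u)) = (lborel :: (real \<times> real) measure)"
    (is "distr _ _ ?f = _")
proof (rule measure_eqI)
  fix A :: "(real \<times> real) set"
  assume "A \<in> sets (distr lborel lborel ?f)"
  then have [measurable]: "A \<in> sets (borel \<Otimes>\<^sub>M borel)" by (simp add: borel_prod[symmetric])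
  have f [measurable]: "?f \<in> borel \<Otimes>\<^sub>M borel \<rightarrow>\<^sub>M borel \<Otimes>\<^sub>M borel" by measurable
  have "emeasure (distr lborel lborel ?f) A = (\<integral>\<^sup>+ u. indicator A u \<partial>distr lborel lborel ?f)"
    by (simp add: borel_prod[symmetric])
  also have "\<dots> = (\<integral>\<^sup>+ u. indicator A (?f u) \<partial>(lborel \<Otimes>\<^sub>M lborel))"
    unfolding lborel_prod using f by (subst nn_integral_distr) (simp_all add: borel_prod[symmetric])
  also have "\<dots> = (\<integral>\<^sup>+ x. \<integral>\<^sup>+ y. indicator A (x, y + k * x) \<partial>lborel \<partial>lborel)"
    by (subst lborel.nn_integral_fst[symmetric]) simp_all
  also have "\<dots> = (\<integral>\<^sup>+ x. \<integral>\<^sup>+ y. indicator A (x, y) \<partial>lborel \<partial>lborel)"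
  proof (rule nn_integral_cong)
    fix x :: real
    show "(\<integral>\<^sup>+ y. indicator A (x, y + k * x) \<partial>lborel) = (\<integral>\<^sup>+ y. indicator A (x, y) \<partial>lborel)"
      by (subst (2) nn_integral_real_affine[where c=1 and t="k * x"]) (simp_all add: add.commute)
  qed
  also have "\<dots> = (\<integral>\<^sup>+ u. indicator A u \<partial>(lborel \<Otimes>\<^sub>M lborel))"
    by (subst lborel.nn_integral_fst[symmetric]) simp_all
  also have "\<dots> = emeasure lborel A"
    unfolding lborel_prod by (simp add: borel_prod[symmetric])
  finally show "emeasure (distr lborel lborel ?f) A = emeasure lborel A" .
qed simp

lemma distr_lborel_uminus_prod:
  "distr lborel lborel uminus = (lborel :: (real \<times> real) measure)"
  using lborel_affine[of "-1" "0 :: real \<times> real"]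
  by (simp add: density_1 one_ennreal_def[symmetric] cong: distr_cong)

text \<open>
  The point with coordinates \<open>(t, s)\<close> in the orthonormal basis \<open>w\<close>, \<^term>\<open>perp w\<close> (when \<open>w\<close> is
  a unit vector): \<^const>\<open>proj\<close> integrates out its second coordinate.
\<close>

definition frame :: "real \<times> real \<Rightarrow> real \<times> real \<Rightarrow> real \<times> real" where
  "frame w u = fst u *\<^sub>R w + snd u *\<^sub>R perp w"

lemma frame_measurable [measurable]: "frame w \<in> borel_measurable borel"
  unfolding frame_def by (intro borel_measurable_continuous_onI continuous_intros)

lemma norm_eq_1_prod: "norm w = 1 \<longleftrightarrow> (fst w)\<^sup>2 + (snd w)\<^sup>2 = (1::real)" for w :: "real \<times> real"
  by (cases w) (auto simp: norm_Pair)

text \<open>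
  A rotation is a product of three shears.  For \<open>w = (cos \<theta>, sin \<theta>)\<close> the horizontal ones have slope
  \<open>- tan (\<theta>/2) = - sin \<theta> / (1 + cos \<theta>)\<close> and the vertical one has slope \<open>sin \<theta>\<close>.  The half turn, for
  which the tangent has a pole, is the point reflection.
\<close>

lemma distr_lborel_frame:
  assumes w: "norm w = 1"
  shows "distr lborel lborel (frame w) = lborel"
proof (cases "fst w = - 1")
  case True
  with w have "w = (-1, 0)"
    by (cases w) (auto simp: norm_eq_1_prod)
  then have "frame w = uminus"
    by (auto simp: frame_def perp_def fun_eq_iff)
  then show ?thesis by (simp add: distr_lborel_uminus_prod)
next
  case False
  define c s k where "c = fst w" and "s = snd w" and "k = - (s / (1 + c))"
  have c: "1 + c \<noteq> 0" using False by (auto simp: c_def)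
  have cs: "c\<^sup>2 + s\<^sup>2 = 1" using w by (simp add: norm_eq_1_prod c_def s_def)
  have k1: "k * (1 + c) = - s" using c by (simp add: k_def)
  have "k * s * (1 + c) = - s\<^sup>2" using arg_cong[OF k1, of "\<lambda>z. z * s"] by (simp add: power2_eq_square mult_ac)
  also have "\<dots> = (c - 1) * (1 + c)" using cs by (simp add: algebra_simps power2_eq_square)
  finally have k2: "k * s = c - 1" using c by simp
  let ?S = "\<lambda>u. (fst u + k * snd u, snd u)" and ?S' = "\<lambda>u. (fst u, snd u + s * fst u)"
  have eq: "frame w = ?S \<circ> (?S' \<circ> ?S)"
  proof (rule ext, clarify, rule prod_eqI)
    fix t r :: real
    have "fst ((?S \<circ> (?S' \<circ> ?S)) (t, r)) = t * (1 + k * s) + r * (k * (2 + k * s))"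
      by (simp add: algebra_simps)
    also have "\<dots> = t * c - r * s" 
      unfolding k2 using k1 by (simp add: algebra_simps)
    finally show "fst (frame w (t, r)) = fst ((?S \<circ> (?S' \<circ> ?S)) (t, r))"
      by (simp add: frame_def perp_def c_def s_def)
    have "snd ((?S \<circ> (?S' \<circ> ?S)) (t, r)) = t * s + r * (1 + k * s)"
      by (simp add: algebra_simps)
    also have "\<dots> = t * s + r * c" 
      unfolding k2 by simp
    finally show "snd (frame w (t, r)) = snd ((?S \<circ> (?S' \<circ> ?S)) (t, r))"
      by (simp add: frame_def perp_def c_def s_def)
  qed
  have m: "?S \<in> lborel \<rightarrow>\<^sub>M lborel" "?S' \<in> lborel \<rightarrow>\<^sub>M lborel"
    by (simp_all add: borel_prod[symmetric])
  have "distr lborel lborel (frame w) = distr (distr (distr lborel lborel ?S) lborel ?S') lborel ?S"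
    unfolding eq using m by (simp add: distr_distr measurable_comp)
  then show ?thesis
    by (simp add: distr_lborel_shear_fst distr_lborel_shear_snd)
qed

lemma inner_perp [simp]: "w \<bullet> perp w = 0" "perp w \<bullet> w = 0"
  by (cases w; simp add: perp_def mult.commute)+

lemma frame_inner [simp]: "norm w = 1 \<Longrightarrow> frame w (t, s) \<bullet> w = t"
  by (simp add: frame_def inner_add_left dot_square_norm)

lemma norm_perp [simp]: "norm (perp w) = norm w"
  by (cases w) (simp add: perp_def norm_Pair add.commute)

lemma norm_frame: "norm w = 1 \<Longrightarrow> norm (frame w (t, s)) = sqrt (t\<^sup>2 + s\<^sup>2)"
  unfolding norm_eq_sqrt_inner frame_def
  by (simp add: inner_add_left inner_add_right power2_eq_square)
     (simp add: dot_square_norm )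

section \<open>The Volterra primitive of a projection is a half-plane integral\<close>

lemma AE_frame:
  assumes "norm w = 1" "AE u in lborel. P u"
  shows "AE u in lborel. P (frame w u)"
proof (rule AE_distrD[where f="frame w" and M=lborel and M'=lborel and P=P])
  show "AE u in distr lborel lborel (frame w). P u"
    unfolding distr_lborel_frame[OF assms(1)] by (rule assms(2))
qed simp

lemma nn_integral_frame:
  assumes "norm w = 1" "g \<in> borel_measurable borel"
  shows "(\<integral>\<^sup>+ u. g (frame w u) \<partial>lborel) = (\<integral>\<^sup>+ u. g u \<partial>lborel)"
  using nn_integral_distr[of "frame w" lborel lborel g] assms
  by (simp add: distr_lborel_frame)

lemma integral_frame:
  fixes g :: "real \<times> real \<Rightarrow> real"
  assumes "norm w = 1" "g \<in> borel_measurable borel"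
  shows "(LINT u|lborel. g (frame w u)) = (LINT u|lborel. g u)"
  using integral_distr[of "frame w" lborel lborel g] assms
  by (simp add: distr_lborel_frame)

lemma integrable_frame:
  fixes g :: "real \<times> real \<Rightarrow> real"
  assumes "norm w = 1" "integrable lborel g"
  shows "integrable lborel (\<lambda>u. g (frame w u))"
  using integrable_distr[of "frame w" lborel lborel g] assms
  by (simp add: distr_lborel_frame)

lemma borel_measurable_lebesgue_cong_AE:
  fixes f g :: "'a :: euclidean_space \<Rightarrow> real"
  assumes g: "g \<in> borel_measurable borel" and ae: "AE x in lborel. f x = g x"
  shows "f \<in> borel_measurable lebesgue"
proof (rule measurableI)
  fix A :: "real set" assume A: "A \<in> sets borel"
  have g': "g -` A \<inter> space lebesgue \<in> sets lebesgue"
    by (rule measurable_sets[OF measurable_completion A]) (simp add: g)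
  have mem: "AE x in lebesgue. x \<in> g -` A \<inter> space lebesgue \<longleftrightarrow> x \<in> f -` A \<inter> space lebesgue"
    using AE_completion[OF ae] by eventually_elim auto
  show "f -` A \<inter> space lebesgue \<in> sets lebesgue"
    by (rule completion.in_sets_AE[OF mem g']) simp
qed auto

lemma integral_lebesgue_cong_AE:
  fixes f g :: "'a :: euclidean_space \<Rightarrow> real"
  assumes g: "g \<in> borel_measurable borel" and ae: "AE x in lborel. f x = g x"
  shows "(LINT x|lebesgue. f x) = (LINT x|lborel. g x)"
proof -
  have "(LINT x|lebesgue. f x) = (LINT x|lebesgue. g x)"
  proof (rule integral_cong_AE)
    show "f \<in> borel_measurable lebesgue" by (rule borel_measurable_lebesgue_cong_AE[OF assms])
    show "g \<in> borel_measurable lebesgue" by (rule measurable_completion) (simp add: g)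
  qed (rule AE_completion[OF ae])
  also have "\<dots> = (LINT x|lborel. g x)"
    by (rule integral_completion) (simp add: g)
  finally show ?thesis .
qed

text \<open>
  A Lebesgue measurable function need not have measurable slices, but it agrees almost everywhere
  with a Borel function, and by Fubini the slices on almost every line inherit the agreement.
\<close>

lemma proj_AE_eq:
  assumes w: "norm w = 1" and G [measurable]: "G \<in> borel_measurable borel"
    and ae: "AE u in lborel. F u = G u"
  shows "AE t in lborel. proj w F t = (LINT s|lborel. G (frame w (t, s)))"
proof -
  have "AE u in lborel \<Otimes>\<^sub>M lborel. F (frame w u) = G (frame w u)"
    unfolding lborel_prod by (rule AE_frame[OF w ae])
  then have "AE t in lborel. AE s in lborel. F (frame w (t, s)) = G (frame w (t, s))"
    by (rule lborel_pair.AE_pair)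
  then show ?thesis
  proof eventually_elim
    case (elim t)
    have "(\<lambda>s. frame w (t, s)) \<in> borel_measurable borel"
      unfolding frame_def by (intro borel_measurable_continuous_onI continuous_intros)
    then have "(\<lambda>s. G (frame w (t, s))) \<in> borel_measurable borel"
      by measurable
    from integral_lebesgue_cong_AE[OF this elim] show ?case
      by (simp add: proj_def frame_def)
  qed
qed

definition half_plane_integral :: "(real \<times> real \<Rightarrow> real) \<Rightarrow> real \<times> real \<Rightarrow> real \<Rightarrow> real" where
  "half_plane_integral G w x = (LINT u|lborel. indicator {..x} (u \<bullet> w) * G u)"

text \<open>
  Fubini in the coordinates of the basis \<open>w\<close>, \<^term>\<open>perp w\<close>: integrating \<open>t\<close> over \<open>[- R, x]\<close> and \<open>s\<close>
  over the line covers the strip \<open>- R \<le> u \<bullet> w \<le> x\<close>, whose lower edge is immaterial because the disc of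
  radius \<open>R\<close> lies above it.
\<close>

lemma volterra_proj:
  assumes w: "norm w = 1" and G: "integrable lborel G"
    and ae: "AE u in lborel. F u = G u"
    and supp: "\<forall>u. u \<notin> cball 0 R \<longrightarrow> G u = 0"
  shows integrable_proj: "integrable lebesgue (proj w F)"
    and volterra_proj_eq: "volterra (- R) (proj w F) x = half_plane_integral G w x"
proof -
  define h where "h t = (LINT s|lborel. G (frame w (t, s)))" for t
  have G' [measurable]: "G \<in> borel_measurable borel" using G by auto
  have iG: "integrable (lborel \<Otimes>\<^sub>M lborel) (\<lambda>u. G (frame w u))"
    unfolding lborel_prod by (rule integrable_frame[OF w G])
  have h: "integrable lborel h"
    unfolding h_def using lborel_pair.integrable_fst'[OF iG] by simp
  then have h' [measurable]: "h \<in> borel_measurable borel" by auto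
  have eq: "AE t in lborel. proj w F t = h t"
    unfolding h_def by (rule proj_AE_eq[OF w G' ae])
  show "integrable lebesgue (proj w F)"
  proof (rule integrable_cong_AE_imp)
    show "integrable lebesgue h" using h by (simp add: integrable_completion)
    show "AE x in lebesgue. h x = proj w F x"
      using AE_completion[OF eq] by eventually_elim simp
  qed (rule borel_measurable_lebesgue_cong_AE[OF h' eq])
  have "volterra (- R) (proj w F) x = (LINT t|lborel. indicator {- R..x} t * h t)"
    unfolding volterra_def set_lebesgue_integral_def real_scaleR_def
  proof (rule integral_lebesgue_cong_AE)
    show "AE t in lborel. indicator {- R..x} t * proj w F t = indicator {- R..x} t * h t"
      using eq by eventually_elim simp
  qed measurable
  also have "\<dots> = (LINT t|lborel. LINT s|lborel. indicator {- R..x} t * G (frame w (t, s)))"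
    by (simp add: h_def)
  also have "\<dots> = (LINT u|(lborel \<Otimes>\<^sub>M lborel). indicator {- R..x} (fst u) * G (frame w u))"
  proof (subst lborel_pair.integral_fst'[symmetric])
    have "integrable (lborel \<Otimes>\<^sub>M lborel) (\<lambda>u. indicator ({- R..x} \<times> UNIV) u *\<^sub>R G (frame w u))"
      by (rule integrable_mult_indicator[OF pair_measureI iG]) simp_all
    then show "integrable (lborel \<Otimes>\<^sub>M lborel) (\<lambda>u. indicator {- R..x} (fst u) * G (frame w u))"
      by (simp add: indicator_def mem_Times_iff)
  qed simp
  also have "\<dots> = (LINT u|lborel. indicator {- R..x} (frame w u \<bullet> w) * G (frame w u))"
    unfolding lborel_prod using w by (intro Bochner_Integration.integral_cong) auto
  also have "\<dots> = (LINT u|lborel. indicator {- R..x} (u \<bullet> w) * G u)"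
    by (rule integral_frame[OF w]) measurable
  also have "\<dots> = half_plane_integral G w x"
    unfolding half_plane_integral_def
  proof (rule Bochner_Integration.integral_cong[OF refl])
    fix u
    have "\<bar>u \<bullet> w\<bar> \<le> norm u"
      using Cauchy_Schwarz_ineq2[of u w] w by simp
    then show "indicator {- R..x} (u \<bullet> w) * G u = indicator {..x} (u \<bullet> w) * G u"
      using supp[rule_format, of u] by (auto simp: indicator_def)
  qed
  finally show "volterra (- R) (proj w F) x = half_plane_integral G w x" .
qed

text \<open>
  The clockwise rotation by \<open>\<delta>\<close>, which is the change of variable in \<^const>\<open>rotated\<close>.
\<close>

definition rot :: "real \<Rightarrow> real \<times> real \<Rightarrow> real \<times> real" where
  "rot \<delta> u = (fst u * cos \<delta> + snd u * sin \<delta>, snd u * cos \<delta> - fst u * sin \<delta>)"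

text \<open>
  Rotating the function amounts to rotating the direction of projection, so both projections can be
  taken of the same function.
\<close>

lemma proj_rotated: "proj w (rotated \<delta> F) = proj (rot \<delta> w) F"
  unfolding proj_def
  by (intro ext Bochner_Integration.integral_cong refl)
     (cases w, simp add: rotated_def rot_def perp_def algebra_simps)

lemma rot_add: "rot a (rot b u) = rot (a + b) u"
  by (simp add: rot_def cos_add sin_add algebra_simps)

lemma rot_0 [simp]: "rot 0 u = u"
  by (simp add: rot_def)

lemma norm_rot [simp]: "norm (rot \<delta> u) = norm u"
proof -
  have "(fst u * cos \<delta> + snd u * sin \<delta>)\<^sup>2 + (snd u * cos \<delta> - fst u * sin \<delta>)\<^sup>2
      = ((fst u)\<^sup>2 + (snd u)\<^sup>2) * ((sin \<delta>)\<^sup>2 + (cos \<delta>)\<^sup>2)"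
    by algebra
  then show ?thesis by (cases u) (simp add: rot_def norm_Pair)
qed

text \<open>The length of the chord of the unit circle that subtends the angle \<open>\<delta>\<close>.\<close>

lemma norm_rot_diff:
  assumes "norm w = 1" "0 \<le> \<delta>" "\<delta> \<le> 2 * pi"
  shows "norm (w - rot \<delta> w) = 2 * sin (\<delta> / 2)"
proof -
  have c: "cos \<delta> = 1 - 2 * (sin (\<delta> / 2))\<^sup>2"
    using cos_double_sin[of "\<delta> / 2"] by simp
  have "(fst w - (fst w * cos \<delta> + snd w * sin \<delta>))\<^sup>2 + (snd w - (snd w * cos \<delta> - fst w * sin \<delta>))\<^sup>2
      = ((fst w)\<^sup>2 + (snd w)\<^sup>2) * (1 - 2 * cos \<delta> + ((sin \<delta>)\<^sup>2 + (cos \<delta>)\<^sup>2))"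
    by algebra
  also have "\<dots> = (2 * sin (\<delta> / 2))\<^sup>2"
    unfolding sin_cos_squared_add using assms(1) c by (simp add: norm_eq_1_prod power_mult_distrib)
  finally have "(norm (w - rot \<delta> w))\<^sup>2 = (2 * sin (\<delta> / 2))\<^sup>2"
    by (cases w) (simp add: rot_def norm_Pair)
  then show ?thesis
    by (rule power2_eq_imp_eq) (use assms in \<open>auto intro!: sin_ge_zero\<close>)
qed

lemma volterra_sliced_difference:
  assumes w: "norm w = 1" and G: "integrable lborel G"
    and ae: "AE u in lborel. F u = G u"
    and supp: "\<forall>u. u \<notin> cball 0 R \<longrightarrow> G u = 0"
  shows "volterra (- R) (\<lambda>t. proj w F t - proj w (rotated \<delta> F) t) x
       = half_plane_integral G w x - half_plane_integral G (rot \<delta> w) x"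
    and "continuous_on {- R..R} (volterra (- R) (\<lambda>t. proj w F t - proj w (rotated \<delta> F) t))"
proof -
  have w': "norm (rot \<delta> w) = 1" using w by simp
  have i: "set_integrable lebesgue {a..b} (proj v F)" if "norm v = 1" for v a b
    unfolding set_integrable_def
    by (rule integrable_mult_indicator[OF _ integrable_proj[OF that G ae supp]]) simp
  have "volterra (- R) (\<lambda>t. proj w F t - proj w (rotated \<delta> F) t) x
      = volterra (- R) (proj w F) x - volterra (- R) (proj (rot \<delta> w) F) x"
    unfolding proj_rotated volterra_def by (rule set_integral_diff(2)[OF i[OF w] i[OF w']])
  also have "\<dots> = half_plane_integral G w x - half_plane_integral G (rot \<delta> w) x"
    by (simp only: volterra_proj_eq[OF w G ae supp] volterra_proj_eq[OF w' G ae supp])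
  finally show "volterra (- R) (\<lambda>t. proj w F t - proj w (rotated \<delta> F) t) x
      = half_plane_integral G w x - half_plane_integral G (rot \<delta> w) x" .
  let ?f = "\<lambda>t. proj w F t - proj w (rotated \<delta> F) t"
  have s: "set_integrable lebesgue {a..b} ?f" for a b
    unfolding proj_rotated by (rule set_integral_diff(1)[OF i[OF w] i[OF w']])
  have "volterra (- R) ?f = (\<lambda>x. integral {- R..x} ?f)"
    unfolding volterra_def by (intro ext set_lebesgue_integral_eq_integral(2) s)
  then show "continuous_on {- R..R} (volterra (- R) ?f)"
    using indefinite_integral_continuous_1[OF set_lebesgue_integral_eq_integral(1)[OF s]] by simp
qed

section \<open>The double wedge between two half-planes\<close>

text \<open>
  For directions that are not parallel, the lines \<open>u \<bullet> w = x\<close> and \<open>u \<bullet> v = x\<close> cross at a point, and this is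
  the part inside the disc of two opposite sectors with that apex, which may itself lie outside the disc.
\<close>

definition wedge :: "real \<Rightarrow> real \<times> real \<Rightarrow> real \<times> real \<Rightarrow> real \<Rightarrow> (real \<times> real) set" where
  "wedge R w v x = {u \<in> cball 0 R. (u \<bullet> w \<le> x) \<noteq> (u \<bullet> v \<le> x)}"

lemma sets_wedge [measurable]: "wedge R w v x \<in> sets borel"
proof -
  have "wedge R w v x = cball 0 R \<inter>
      (({u. w \<bullet> u \<le> x} - {u. v \<bullet> u \<le> x}) \<union> ({u. v \<bullet> u \<le> x} - {u. w \<bullet> u \<le> x}))"
    by (auto simp: wedge_def inner_commute)
  then show ?thesis
    by (auto intro!: borel_closed closed_halfspace_le)
qed

lemma wedge_triangle: "wedge R w v' x \<subseteq> wedge R w v x \<union> wedge R v v' x"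
  by (auto simp: wedge_def)

lemma inner_frame_rot:
  assumes "norm w = 1"
  shows "frame w (t, s) \<bullet> rot \<epsilon> w = t * cos \<epsilon> - s * sin \<epsilon>"
proof -
  have "frame w (t, s) \<bullet> rot \<epsilon> w = ((fst w)\<^sup>2 + (snd w)\<^sup>2) * (t * cos \<epsilon> - s * sin \<epsilon>)"
    by (cases w) (simp add: frame_def rot_def perp_def algebra_simps power2_eq_square)
  then show ?thesis using assms by (simp add: norm_eq_1_prod)
qed

lemma has_integral_affine_abs:
  assumes "0 \<le> R"
  shows "((\<lambda>s. a + b * \<bar>s\<bar>) has_integral (2 * R * a + b * R\<^sup>2)) {- R..R :: real}"
proof -
  have "((\<lambda>s. a - b * s) has_integral (a * 0 - b * 0\<^sup>2 / 2) - (a * (- R) - b * (- R)\<^sup>2 / 2)) {- R..0}"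
    using assms by (intro fundamental_theorem_of_calculus)
      (auto intro!: derivative_eq_intros simp: has_real_derivative_iff_has_vector_derivative[symmetric])
  then have 1: "((\<lambda>s. a + b * \<bar>s\<bar>) has_integral (a * R + b * R\<^sup>2 / 2)) {- R..0}"
    by (rule has_integral_eq_rhs[OF has_integral_eq, rotated]) auto
  have "((\<lambda>s. a + b * s) has_integral (a * R + b * R\<^sup>2 / 2) - (a * 0 + b * 0\<^sup>2 / 2)) {0..R}"
    using assms by (intro fundamental_theorem_of_calculus)
      (auto intro!: derivative_eq_intros simp: has_real_derivative_iff_has_vector_derivative[symmetric])
  then have 2: "((\<lambda>s. a + b * \<bar>s\<bar>) has_integral (a * R + b * R\<^sup>2 / 2)) {0..R}"
    by (rule has_integral_eq_rhs[OF has_integral_eq, rotated]) auto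
  show ?thesis
    using has_integral_combine[OF _ _ 1 2] assms by (simp add: algebra_simps)
qed

text \<open>
  Only the first-order term \<open>\<epsilon> R\<^sup>2\<close> of this bound survives the subdivision below.  On the line
  at height \<open>s\<close> along \<^term>\<open>perp w\<close>, the wedge lies between the two boundary lines, at \<open>t = x\<close> and at
  \<open>t = (x + s sin \<epsilon>) / cos \<epsilon>\<close>.  Their distance is at most \<open>(\<bar>x\<bar> (1 - cos \<epsilon>) + \<bar>s\<bar> sin \<epsilon>) / cos \<epsilon>\<close>,
  and it only remains to integrate this over \<open>\<bar>s\<bar> \<le> R\<close>.
\<close>

lemma emeasure_wedge_small:
  assumes w: "norm w = 1" and \<epsilon>: "0 \<le> \<epsilon>" "\<epsilon> < pi / 2" and "0 \<le> R"
  shows "emeasure lborel (wedge R w (rot \<epsilon> w) x)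
    \<le> ennreal ((2 * R * \<bar>x\<bar> * (1 - cos \<epsilon>) + R\<^sup>2 * sin \<epsilon>) / cos \<epsilon>)"
proof -
  let ?W = "wedge R w (rot \<epsilon> w) x"
  define y where "y s = (x + s * sin \<epsilon>) / cos \<epsilon>" for s
  define a b where "a = \<bar>x\<bar> * (1 - cos \<epsilon>) / cos \<epsilon>" and "b = sin \<epsilon> / cos \<epsilon>"
  have cos: "0 < cos \<epsilon>" using \<epsilon> by (intro cos_gt_zero_pi) auto
  have sin: "0 \<le> sin \<epsilon>" using \<epsilon> by (intro sin_ge_zero) auto
  have ab: "0 \<le> a" "0 \<le> b" using cos sin by (auto simp: a_def b_def)
  have m: "(\<lambda>u. indicator ?W (frame w u) :: ennreal) \<in> borel_measurable (lborel \<Otimes>\<^sub>M lborel)"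
    unfolding lborel_prod by measurable
  have y: "\<bar>x - y s\<bar> \<le> a + b * \<bar>s\<bar>" for s
  proof -
    have "x - y s = - (x * (1 - cos \<epsilon>) + s * sin \<epsilon>) / cos \<epsilon>"
      using cos by (simp add: y_def field_simps)
    then have "\<bar>x - y s\<bar> = \<bar>x * (1 - cos \<epsilon>) + s * sin \<epsilon>\<bar> / cos \<epsilon>"
      using cos by (simp only: abs_divide abs_minus_cancel abs_of_pos)
    also have "\<dots> \<le> (\<bar>x * (1 - cos \<epsilon>)\<bar> + \<bar>s * sin \<epsilon>\<bar>) / cos \<epsilon>"
      using cos by (intro divide_right_mono) auto
    also have "\<dots> = a + b * \<bar>s\<bar>"
      using sin by (simp add: a_def b_def abs_mult add_divide_distrib)
    finally show ?thesis .
  qed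
  have ind: "indicator ?W (frame w (t, s))
      \<le> indicator {- R..R} s * (indicator {min x (y s)..max x (y s)} t :: ennreal)" for t s
  proof (cases "frame w (t, s) \<in> ?W")
    case True
    then have n: "sqrt (t\<^sup>2 + s\<^sup>2) \<le> R" and ne: "(t \<le> x) \<noteq> (t * cos \<epsilon> - s * sin \<epsilon> \<le> x)"
      using w by (auto simp: wedge_def inner_frame_rot norm_frame)
    have "\<bar>s\<bar> \<le> sqrt (t\<^sup>2 + s\<^sup>2)" by (rule real_le_rsqrt) simp
    then have "\<bar>s\<bar> \<le> R" using n by (rule order_trans)
    then have "s \<in> {- R..R}" by (simp add: abs_le_iff)
    moreover have "t * cos \<epsilon> - s * sin \<epsilon> \<le> x \<longleftrightarrow> t \<le> y s"
      using cos by (auto simp: y_def field_simps)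
    with ne have "t \<in> {min x (y s)..max x (y s)}" by auto
    ultimately show ?thesis by (simp add: indicator_def)
  qed simp
  have "emeasure lborel ?W = (\<integral>\<^sup>+ u. indicator ?W u \<partial>lborel)"
    by simp
  also have "\<dots> = (\<integral>\<^sup>+ u. indicator ?W (frame w u) \<partial>(lborel \<Otimes>\<^sub>M lborel))"
    unfolding lborel_prod by (rule nn_integral_frame[OF w, symmetric]) measurable
  also have "\<dots> = (\<integral>\<^sup>+ s. \<integral>\<^sup>+ t. indicator ?W (frame w (t, s)) \<partial>lborel \<partial>lborel)"
    by (rule lborel_pair.nn_integral_snd[OF m, symmetric])
  also have "\<dots> \<le> (\<integral>\<^sup>+ s. \<integral>\<^sup>+ t. indicator {- R..R} s * indicator {min x (y s)..max x (y s)} t \<partial>lborel \<partial>lborel)"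
    by (intro nn_integral_mono ind)
  also have "\<dots> = (\<integral>\<^sup>+ s. indicator {- R..R} s * ennreal \<bar>x - y s\<bar> \<partial>lborel)"
    by (intro nn_integral_cong) (simp add: nn_integral_cmult abs_real_def max_def min_def)
  also have "\<dots> \<le> (\<integral>\<^sup>+ s. ennreal (a + b * \<bar>s\<bar>) * indicator {- R..R} s \<partial>lborel)"
    by (intro nn_integral_mono) (auto simp: indicator_def intro!: ennreal_leI y)
  also have "\<dots> = ennreal (2 * R * a + b * R\<^sup>2)"
    using assms ab by (intro nn_integral_has_integral_lebesgue' has_integral_affine_abs) auto
  also have "2 * R * a + b * R\<^sup>2 = (2 * R * \<bar>x\<bar> * (1 - cos \<epsilon>) + R\<^sup>2 * sin \<epsilon>) / cos \<epsilon>"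
    by (simp add: a_def b_def add_divide_distrib mult_ac)
  finally show ?thesis .
qed

lemma emeasure_wedge_subdivision:
  assumes w: "norm w = 1" and \<epsilon>: "0 \<le> \<epsilon>" "\<epsilon> < pi / 2" and "0 \<le> R"
  shows "emeasure lborel (wedge R w (rot (real n * \<epsilon>) w) x)
    \<le> ennreal (real n * ((2 * R * \<bar>x\<bar> * (1 - cos \<epsilon>) + R\<^sup>2 * sin \<epsilon>) / cos \<epsilon>))"
proof (induction n)
  case 0
  then show ?case by (simp add: wedge_def)
next
  case (Suc n)
  let ?c = "(2 * R * \<bar>x\<bar> * (1 - cos \<epsilon>) + R\<^sup>2 * sin \<epsilon>) / cos \<epsilon>"
  have "0 < cos \<epsilon>" "0 \<le> sin \<epsilon>" using \<epsilon> by (auto intro!: cos_gt_zero_pi sin_ge_zero)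
  then have c: "0 \<le> ?c" using \<open>0 \<le> R\<close> by auto
  have eq: "rot (real (Suc n) * \<epsilon>) w = rot \<epsilon> (rot (real n * \<epsilon>) w)"
    by (simp add: rot_add algebra_simps)
  have "emeasure lborel (wedge R w (rot (real (Suc n) * \<epsilon>) w) x)
      \<le> emeasure lborel (wedge R w (rot (real n * \<epsilon>) w) x
          \<union> wedge R (rot (real n * \<epsilon>) w) (rot (real (Suc n) * \<epsilon>) w) x)"
    by (intro emeasure_mono wedge_triangle) simp
  also have "\<dots> \<le> emeasure lborel (wedge R w (rot (real n * \<epsilon>) w) x)
      + emeasure lborel (wedge R (rot (real n * \<epsilon>) w) (rot (real (Suc n) * \<epsilon>) w) x)"
    by (intro emeasure_subadditive) simp_all
  also have "\<dots> \<le> ennreal (real n * ?c) + ennreal ?c"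
    unfolding eq using assms by (intro add_mono Suc emeasure_wedge_small) auto
  also have "\<dots> = ennreal (real (Suc n) * ?c)"
    unfolding of_nat_Suc distrib_right mult_1_left using c
    by (subst ennreal_plus[symmetric]) (auto simp only: add.commute intro!: mult_nonneg_nonneg of_nat_0_le_iff)
  finally show ?case .
qed

text \<open>
  Turning through \<open>\<delta>\<close> in \<open>n\<close> equal steps costs \<open>n\<close> times the bound for one step of \<open>\<delta> / n\<close>.  As
  \<open>n \<rightarrow> \<infinity>\<close> the terms of second order disappear and \<open>\<delta> R\<^sup>2\<close> is left.  This avoids computing the
  area, whose shape depends on whether the apex of the wedge lies in the disc.
\<close>

lemma emeasure_wedge_le:
  assumes w: "norm w = 1" and \<delta>: "0 \<le> \<delta>" and R: "0 \<le> R"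
  shows "emeasure lborel (wedge R w (rot \<delta> w) x) \<le> ennreal (\<delta> * R\<^sup>2)"
proof (rule tendsto_lowerbound)
  let ?f = "\<lambda>n. real n * ((2 * R * \<bar>x\<bar> * (1 - cos (\<delta> / real n)) + R\<^sup>2 * sin (\<delta> / real n)) / cos (\<delta> / real n))"
  show "(\<lambda>n. ennreal (?f n)) \<longlonglongrightarrow> ennreal (\<delta> * R\<^sup>2)"
  proof (cases "\<delta> = 0")
    case False
    then have "0 < \<delta>" using \<delta> by simp
    then have "?f \<longlonglongrightarrow> \<delta> * R\<^sup>2" by real_asymp
    then show ?thesis by (rule tendsto_ennrealI)
  qed simp
  have "(\<lambda>n. \<delta> / real n) \<longlonglongrightarrow> 0" by real_asymp
  then have "eventually (\<lambda>n. \<delta> / real n < pi / 2) sequentially"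
    by (rule order_tendstoD) simp
  then show "eventually (\<lambda>n. emeasure lborel (wedge R w (rot \<delta> w) x) \<le> ennreal (?f n)) sequentially"
    using eventually_gt_at_top[of 0]
  proof eventually_elim
    case (elim n)
    then show ?case
      using emeasure_wedge_subdivision[OF w _ elim(1) R, of n x] \<delta> by simp
  qed
qed simp

lemma emeasure_thresholds_between_le:
  "(\<integral>\<^sup>+ x. indicator {x. (a \<le> x) \<noteq> (b \<le> x)} x \<partial>lborel) \<le> ennreal \<bar>a - b\<bar>" for a b :: real
proof -
  have "(\<integral>\<^sup>+ x. indicator {x. (a \<le> x) \<noteq> (b \<le> x)} x \<partial>lborel) \<le> (\<integral>\<^sup>+ x. indicator {min a b..max a b} x \<partial>lborel)"
    by (intro nn_integral_mono) (auto simp: indicator_def)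
  also have "\<dots> = ennreal \<bar>a - b\<bar>"
    by (simp add: abs_real_def max_def min_def)
  finally show ?thesis .
qed

text \<open>
  By Tonelli this is the mean of \<open>k u\<close> against the length of the set of offsets \<open>x\<close> whose wedge
  contains \<open>u\<close>.  These are the \<open>x\<close> between \<open>u \<bullet> w\<close> and \<open>u \<bullet> v\<close>, so the length is at most
  \<open>\<bar>u \<bullet> (w - v)\<bar> \<le> R \<parallel>w - v\<parallel>\<close>.
\<close>

lemma nn_integral_wedge_offsets_le:
  assumes k [measurable]: "k \<in> borel_measurable borel"
  shows "(\<integral>\<^sup>+ x. \<integral>\<^sup>+ u. k u * indicator (wedge R w v x) u \<partial>lborel \<partial>lborel)
    \<le> ennreal (R * norm (w - v)) * (\<integral>\<^sup>+ u. k u \<partial>lborel)"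
proof -
  have "(\<integral>\<^sup>+ x. \<integral>\<^sup>+ u. k u * indicator (wedge R w v x) u \<partial>lborel \<partial>lborel)
      = (\<integral>\<^sup>+ u. \<integral>\<^sup>+ x. k u * indicator (wedge R w v x) u \<partial>lborel \<partial>lborel)"
  proof (rule lborel_pair.Fubini'[symmetric])
    define S T where "S = {z :: real \<times> real \<times> real. snd z \<bullet> w \<le> fst z}"
      and "T = {z :: real \<times> real \<times> real. snd z \<bullet> v \<le> fst z}"
    have "closed S" "closed T" "closed (UNIV \<times> cball 0 R :: (real \<times> real \<times> real) set)"
      unfolding S_def T_def by (intro closed_Collect_le closed_Times continuous_intros; simp)+
    then have [measurable]: "(UNIV \<times> cball 0 R) \<inter> ((S - T) \<union> (T - S)) \<in> sets (borel \<Otimes>\<^sub>M borel)"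
      unfolding borel_prod by (intro sets.Int sets.Un sets.Diff borel_closed)
    have "(\<lambda>(x, u). k u * indicator (wedge R w v x) u)
        = (\<lambda>z. k (snd z) * indicator ((UNIV \<times> cball 0 R) \<inter> ((S - T) \<union> (T - S))) z)"
      by (auto simp: wedge_def S_def T_def indicator_def fun_eq_iff)
    also have "\<dots> \<in> borel_measurable (borel \<Otimes>\<^sub>M borel)"
      by measurable
    finally show "(\<lambda>(x, u). k u * indicator (wedge R w v x) u) \<in> borel_measurable (lborel \<Otimes>\<^sub>M lborel)"
      by simp
  qed
  also have "\<dots> \<le> (\<integral>\<^sup>+ u. k u * ennreal (R * norm (w - v)) \<partial>lborel)"
  proof (rule nn_integral_mono)
    fix u
    show "(\<integral>\<^sup>+ x. k u * indicator (wedge R w v x) u \<partial>lborel) \<le> k u * ennreal (R * norm (w - v))"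
    proof (cases "u \<in> cball 0 R")
      case True
      have "(\<integral>\<^sup>+ x. k u * indicator (wedge R w v x) u \<partial>lborel)
        = (\<integral>\<^sup>+ x. k u * indicator {x. (u \<bullet> w \<le> x) \<noteq> (u \<bullet> v \<le> x)} x \<partial>lborel)"
        using True by (intro nn_integral_cong) (auto simp: wedge_def indicator_def)
      also have "\<dots> = k u * (\<integral>\<^sup>+ x. indicator {x. (u \<bullet> w \<le> x) \<noteq> (u \<bullet> v \<le> x)} x \<partial>lborel)"
        by (rule nn_integral_cmult) simp
      also have "\<dots> \<le> k u * ennreal \<bar>u \<bullet> w - u \<bullet> v\<bar>"
        by (intro mult_left_mono emeasure_thresholds_between_le) simp
      also have "\<dots> \<le> k u * ennreal (R * norm (w - v))"
      proof (intro mult_left_mono ennreal_leI)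
        have "\<bar>u \<bullet> w - u \<bullet> v\<bar> \<le> norm u * norm (w - v)"
          using Cauchy_Schwarz_ineq2[of u "w - v"] by (simp add: inner_diff_right)
        also have "\<dots> \<le> R * norm (w - v)"
          using True by (intro mult_right_mono) auto
        finally show "\<bar>u \<bullet> w - u \<bullet> v\<bar> \<le> R * norm (w - v)" .
      qed simp
      finally show ?thesis .
    qed (simp add: wedge_def)
  qed
  also have "\<dots> = ennreal (R * norm (w - v)) * (\<integral>\<^sup>+ u. k u \<partial>lborel)"
    by (subst nn_integral_multc) (simp_all add: mult.commute)
  finally show ?thesis .
qed

lemma half_plane_integral_diff_le:
  assumes G: "integrable lborel G" and supp: "\<forall>u. u \<notin> cball 0 R \<longrightarrow> G u = 0"
  shows "ennreal \<bar>half_plane_integral G w x - half_plane_integral G v x\<bar>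
    \<le> (\<integral>\<^sup>+ u. ennreal \<bar>G u\<bar> * indicator (wedge R w v x) u \<partial>lborel)"
proof -
  have i: "integrable lborel (\<lambda>u. indicator {..x} (u \<bullet> w) * G u)" for w
  proof -
    have "{u. u \<bullet> w \<le> x} \<in> sets lborel"
      by (simp add: borel_closed closed_Collect_le continuous_intros)
    then have "integrable lborel (\<lambda>u. indicator {u. u \<bullet> w \<le> x} u *\<^sub>R G u)"
      using G by (rule integrable_mult_indicator)
    then show ?thesis by (simp add: indicator_def)
  qed
  let ?d = "\<lambda>u. indicator {..x} (u \<bullet> w) * G u - indicator {..x} (u \<bullet> v) * G u"
  have "half_plane_integral G w x - half_plane_integral G v x = (LINT u|lborel. ?d u)"
    unfolding half_plane_integral_def by (rule Bochner_Integration.integral_diff[OF i i, symmetric])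
  then have "ennreal \<bar>half_plane_integral G w x - half_plane_integral G v x\<bar> \<le> (\<integral>\<^sup>+ u. norm (?d u) \<partial>lborel)"
    using integral_norm_bound_ennreal[OF Bochner_Integration.integrable_diff[OF i[of w] i[of v]]] by simp
  also have "\<dots> = (\<integral>\<^sup>+ u. ennreal \<bar>G u\<bar> * indicator (wedge R w v x) u \<partial>lborel)"
    using supp by (intro nn_integral_cong) (auto simp: indicator_def wedge_def)
  finally show ?thesis .
qed

section \<open>Measurability of the essential supremum in the direction\<close>

text \<open>
  For \<open>p = \<infinity>\<close> the outer essential supremum is only meaningful (it is \<open>\<infinity>\<close> by convention otherwise) for
  a measurable function of \<open>w\<close>.  The inner one is therefore written as a countable supremum of
  functions that are measurable in \<open>w\<close> by Fubini.
\<close>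

lemma borel_measurable_half_plane_integral:
  assumes [measurable]: "G \<in> borel_measurable borel"
  shows "(\<lambda>w. half_plane_integral G w x) \<in> borel_measurable borel"
proof -
  have "closed {z :: (real \<times> real) \<times> (real \<times> real). snd z \<bullet> fst z \<le> x}"
    by (intro closed_Collect_le continuous_intros)
  then have [measurable]: "{z :: (real \<times> real) \<times> (real \<times> real). snd z \<bullet> fst z \<le> x} \<in> sets (borel \<Otimes>\<^sub>M borel)"
    unfolding borel_prod by (rule borel_closed)
  have "(\<lambda>(w, u). indicator {..x} (u \<bullet> w) * G u)
      = (\<lambda>z. indicator {z. snd z \<bullet> fst z \<le> x} z * G (snd z))"
    by (auto simp: fun_eq_iff indicator_def)
  also have "\<dots> \<in> borel_measurable (borel \<Otimes>\<^sub>M borel)" by measurable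
  finally have "(\<lambda>(w, u). indicator {..x} (u \<bullet> w) * G u) \<in> borel_measurable (borel \<Otimes>\<^sub>M lborel)"
    by (simp cong: measurable_cong_sets)
  then show ?thesis
    unfolding half_plane_integral_def by (rule lborel.borel_measurable_lebesgue_integral)
qed

text \<open>
  A nonstrict inequality between a continuous function and a constant extends to the closed interval
  from any dense subset of it: here from the rational points, and from a set of full measure.
\<close>

lemma esssup_continuous_eq_SUP:
  fixes f :: "real \<Rightarrow> real"
  assumes ab: "a < b" and f: "continuous_on {a..b} f"
  shows "esssup (lebesgue_on {a..b}) (\<lambda>x. ennreal (f x)) = (SUP x\<in>{a..b} \<inter> \<rat>. ennreal (f x))"
    (is "?E = ?S")
proof (rule antisym)
  have m: "(\<lambda>x. ennreal (f x)) \<in> borel_measurable (lebesgue_on {a..b})"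
    using continuous_imp_measurable_on_sets_lebesgue[OF f] by simp
  show "?E \<le> ?S"
  proof (cases ?S)
    case (real s)
    have "closure ({a<..<b} \<inter> \<rat>) = {a..b}"
      using ab by (subst closure_open_Int_superset) (auto simp: Rats_closure_real)
    moreover have "f y \<le> s" if "y \<in> {a<..<b} \<inter> \<rat>" for y
    proof -
      have "ennreal (f y) \<le> ?S" using that by (intro SUP_upper) auto
      then show ?thesis unfolding real(2) using real(1) by (simp add: ennreal_le_iff)
    qed
    ultimately have "f x \<le> s" if "x \<in> {a..b}" for x
      using continuous_le_on_closure[of "{a<..<b} \<inter> \<rat>" f x s] f that by simp
    then show ?thesis
      unfolding real(2) by (intro esssup_I[OF m] AE_I2) (simp add: ennreal_leI)
  next
    case top
    then show ?thesis by (simp only: top_greatest)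
  qed
  show "?S \<le> ?E"
  proof (cases ?E)
    case (real e)
    let ?C = "{x \<in> {a..b}. f x \<le> e}"
    have "AE x in lebesgue_on {a..b}. ennreal (f x) \<le> ennreal e"
      using esssup_AE[of "\<lambda>x. ennreal (f x)" "lebesgue_on {a..b}"] unfolding real(2) .
    then have "AE x in lebesgue. x \<in> {a..b} \<longrightarrow> f x \<le> e"
      using real(1) by (subst (asm) AE_restrict_space_iff) (simp_all add: ennreal_le_iff)
    then have ae: "AE x\<in>{a<..<b} in lebesgue. x \<in> ?C"
      by eventually_elim auto
    have closed: "closed ?C"
      using continuous_closed_preimage[OF f, of "{..e}"] by (simp add: vimage_def Int_def)
    have "{a<..<b} \<subseteq> ?C"
      by (intro subsetI mem_closed_if_AE_lebesgue_open[OF _ closed ae]) auto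
    then have "closure {a<..<b} \<subseteq> ?C" using closed by (rule closure_minimal)
    then have "f x \<le> e" if "x \<in> {a..b}" for x using that ab by auto
    then show ?thesis unfolding real(2) by (intro SUP_least ennreal_leI) auto
  next
    case top
    then show ?thesis by (simp only: top_greatest)
  qed
qed

section \<open>Extended powers and norms\<close>

lemma epowr_ennreal: "0 \<le> a \<Longrightarrow> epowr (ennreal a) r = ennreal (a powr r)"
  by (simp add: epowr_def)

lemma epowr_mono:
  assumes "x \<le> y" "0 \<le> r"
  shows "epowr x r \<le> epowr y r"
proof (cases "y = \<infinity>")
  case False
  then have "x \<noteq> \<infinity>" using assms(1) by (auto simp: top_unique)
  moreover have "enn2real x \<le> enn2real y"
    using assms False by (intro enn2real_mono) (auto simp: less_top)
  ultimately show ?thesis using False assms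
    by (auto simp: epowr_def intro!: ennreal_leI powr_mono2)
qed (simp add: epowr_def)

lemma eLp_norm_le_of_bounded:
  assumes "prob_space M" and p: "1 \<le> p" and le: "\<And>x. x \<in> space M \<Longrightarrow> f x \<le> K"
    and m: "p = \<infinity> \<Longrightarrow> f \<in> borel_measurable M"
  shows "eLp_norm p M f \<le> K"
proof (cases "p = \<infinity>")
  case True
  then show ?thesis
    using le m by (auto simp: eLp_norm_def intro!: esssup_I)
next
  case p': False
  interpret prob_space M by fact
  define q where "q = enn2real p"
  have q: "1 \<le> q" using p p' enn2real_mono[of 1 p] by (simp add: q_def less_top)
  show ?thesis
  proof (cases K)
    case (real c)
    have "(\<integral>\<^sup>+ x. epowr (f x) q \<partial>M) \<le> (\<integral>\<^sup>+ x. epowr K q \<partial>M)"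
      using q by (intro nn_integral_mono epowr_mono le) auto
    also have "\<dots> = epowr K q" by (simp add: emeasure_space_1)
    finally have "epowr (\<integral>\<^sup>+ x. epowr (f x) q \<partial>M) (1 / q) \<le> epowr (epowr K q) (1 / q)"
      using q by (intro epowr_mono) auto
    also have "\<dots> = K" using q real by (simp add: epowr_ennreal powr_powr)
    finally show ?thesis using p' by (simp add: eLp_norm_def q_def)
  qed simp
qed

lemma Lp_norm_lebesgue_cong:
  assumes G: "G \<in> borel_measurable borel" and ae: "AE u in lborel. F u = G u"
  shows "Lp_norm p lebesgue F = Lp_norm p lborel G"
proof (cases "p = \<infinity>")
  case True
  have F: "F \<in> borel_measurable lebesgue" by (rule borel_measurable_lebesgue_cong_AE[OF G ae])
  have m: "(\<lambda>u. ennreal \<bar>F u\<bar>) \<in> borel_measurable lebesgue" "(\<lambda>u. ennreal \<bar>G u\<bar>) \<in> borel_measurable lborel"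
    using F G by simp_all
  have "(AE u in lebesgue. ennreal \<bar>F u\<bar> \<le> z) \<longleftrightarrow> (AE u in lborel. ennreal \<bar>G u\<bar> \<le> z)" for z
    unfolding AE_completion_iff by (rule eventually_subst, use ae in eventually_elim, simp)
  then show ?thesis
    using True m by (simp add: Lp_norm_def eLp_norm_def esssup_eq_AE)
next
  case False
  have "(\<integral>\<^sup>+ u. epowr (ennreal \<bar>F u\<bar>) r \<partial>lborel) = (\<integral>\<^sup>+ u. epowr (ennreal \<bar>G u\<bar>) r \<partial>lborel)" for r
    by (rule nn_integral_cong_AE, use ae in eventually_elim, simp)
  with False show ?thesis
    by (simp add: Lp_norm_def eLp_norm_def nn_integral_completion)
qed

lemma eLp_norm_zero: "eLp_norm p M (\<lambda>x. 0) = 0"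
proof -
  have "esssup M (\<lambda>x. 0 :: ennreal) \<le> 0" by (rule esssup_I) auto
  then show ?thesis by (simp add: eLp_norm_def epowr_def)
qed

section \<open>From wedges to Volterra norms\<close>

text \<open>
  Young's inequality at scale \<open>l\<close>: the right-hand side is the tangent to the concave function
  \<open>z \<mapsto> z\<^bsup>1/q\<^esup>\<close> at \<open>l\<^bsup>q\<^esup>\<close>, evaluated at \<open>z = y\<^bsup>q\<^esup>\<close>.
\<close>

lemma tangent_bound_powr:
  fixes y l q :: real
  assumes "0 \<le> y" "0 < l" "1 \<le> q"
  shows "y \<le> l * ((y powr q / l powr q) / q + (1 - 1 / q))"
proof (cases "y = 0")
  case False
  have "((y / l) powr q) powr (1 / q) * 1 powr (1 - 1 / q) \<le> (1 / q) * (y / l) powr q + (1 - 1 / q) * 1"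
    using assms False by (intro Youngs_inequality_0) auto
  then have "y / l \<le> (y powr q / l powr q) / q + (1 - 1 / q)"
    using assms by (simp add: powr_powr powr_divide mult.commute)
  then show ?thesis using assms by (simp add: field_simps)
qed (use assms in auto)

text \<open>
  Hoelder's inequality against the indicator of \<open>W\<close>, with \<open>1 - 1/q\<close> as the reciprocal of the conjugate
  exponent.  It follows by integrating the tangent bound over \<open>W\<close>, at the scale \<open>l\<close> that makes
  \<open>l\<^bsup>q\<^esup>\<close> the ratio of the \<open>q\<close>-th moment to \<open>m\<close>.
\<close>

lemma Hoelder_indicator:
  fixes g :: "'a \<Rightarrow> real"
  assumes g [measurable]: "g \<in> borel_measurable M" and W [measurable]: "W \<in> sets M"
    and g0: "\<And>u. 0 \<le> g u"
    and m: "emeasure M W \<le> ennreal m" and m0: "0 < m" and q: "1 \<le> q"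
  shows "epowr (\<integral>\<^sup>+ u. ennreal (g u) * indicator W u \<partial>M) q
    \<le> ennreal (m powr (q - 1)) * (\<integral>\<^sup>+ u. ennreal (g u powr q) * indicator W u \<partial>M)"
    (is "epowr ?B q \<le> _ * ?A")
proof (cases ?A)
  case top
  then show ?thesis using m0 by (simp add: ennreal_mult_top)
next
  case (real a)
  show ?thesis
  proof (cases "a = 0")
    case True
    then have "?A = 0" using real by simp
    then have "AE u in M. ennreal (g u powr q) * indicator W u = 0"
      by (subst (asm) nn_integral_0_iff_AE) auto
    then have "AE u in M. ennreal (g u) * indicator W u = 0"
      by eventually_elim (use g0 in \<open>auto simp: indicator_def powr_eq_0_iff split: if_splits\<close>)
    then have "?B = 0" by (subst nn_integral_0_iff_AE) auto
    then show ?thesis by (simp add: epowr_def)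
  next
    case False
    then have a: "0 < a" using real by simp
    \<comment> \<open>At this scale the two terms of the tangent bound add up to exactly \<open>l * m\<close>.\<close>
    define l where "l = (a / m) powr (1 / q)"
    have l: "0 < l" using a m0 by (simp add: l_def)
    have lq: "l powr q = a / m" using a m0 q by (simp add: l_def powr_powr)
    define c d where "c = l / (l powr q * q)" and "d = l * (1 - 1 / q)"
    have cd: "0 \<le> c" "0 \<le> d" using l q by (auto simp: c_def d_def)
    have "?B \<le> (\<integral>\<^sup>+ u. ennreal c * (ennreal (g u powr q) * indicator W u) + ennreal d * indicator W u \<partial>M)"
    proof (rule nn_integral_mono)
      fix u
      have "g u \<le> c * g u powr q + d"
        using tangent_bound_powr[OF g0 l q, of u] by (simp add: c_def d_def algebra_simps)
      then have "ennreal (g u) \<le> ennreal c * ennreal (g u powr q) + ennreal d"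
        using cd by (simp add: ennreal_mult[symmetric] ennreal_plus[symmetric] ennreal_leI del: ennreal_plus)
      then show "ennreal (g u) * indicator W u
          \<le> ennreal c * (ennreal (g u powr q) * indicator W u) + ennreal d * indicator W u"
        by (auto simp: indicator_def)
    qed
    also have "\<dots> = ennreal c * ?A + ennreal d * emeasure M W"
      by (simp add: nn_integral_add nn_integral_cmult)
    also have "\<dots> \<le> ennreal c * ennreal a + ennreal d * ennreal m"
      using real m by (intro add_mono mult_left_mono) auto
    also have "\<dots> = ennreal (c * a + d * m)"
      using cd a m0 by (simp add: ennreal_mult)
    also have "c * a + d * m = l * m"
      unfolding c_def d_def lq using a m0 q by (simp add: field_simps)
    finally have "epowr ?B q \<le> epowr (ennreal (l * m)) q"
      using q by (intro epowr_mono) auto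
    also have "\<dots> = ennreal ((l * m) powr q)" using l m0 by (intro epowr_ennreal) auto
    also have "(l * m) powr q = m powr (q - 1) * a"
      using l m0 by (simp add: powr_mult lq powr_diff)
    finally show ?thesis using real a by (simp add: ennreal_mult)
  qed
qed

text \<open>
  Integrating a bound on the \<open>p\<close>-th power by a mass in the wedge at offset \<open>x\<close> over all \<open>x\<close> costs
  only the factor \<open>R \<parallel>w - v\<parallel>\<close>.  This is the source of the factor \<open>(2 sin (\<delta>/2))\<^bsup>1/p\<^esup>\<close>.
\<close>

lemma Lp_norm_interval_le:
  assumes p: "1 \<le> p" "p \<noteq> \<infinity>"
    and k: "k \<in> borel_measurable borel"
    and V: "\<And>x. ennreal (\<bar>V x\<bar> powr enn2real p) \<le> (\<integral>\<^sup>+ u. k u * indicator (wedge R w v x) u \<partial>lborel)"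
  shows "Lp_norm p (lebesgue_on {a..b}) V
    \<le> epowr (ennreal (R * norm (w - v)) * (\<integral>\<^sup>+ u. k u \<partial>lborel)) (1 / enn2real p)"
proof -
  have "(\<integral>\<^sup>+ x. epowr (ennreal \<bar>V x\<bar>) (enn2real p) \<partial>lebesgue_on {a..b})
      = (\<integral>\<^sup>+ x. ennreal (\<bar>V x\<bar> powr enn2real p) * indicator {a..b} x \<partial>lborel)"
    by (simp add: nn_integral_restrict_space nn_integral_completion epowr_ennreal)
  also have "\<dots> \<le> (\<integral>\<^sup>+ x. \<integral>\<^sup>+ u. k u * indicator (wedge R w v x) u \<partial>lborel \<partial>lborel)"
    by (intro nn_integral_mono) (use V in \<open>auto simp: indicator_def\<close>)
  also have "\<dots> \<le> ennreal (R * norm (w - v)) * (\<integral>\<^sup>+ u. k u \<partial>lborel)"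
    by (rule nn_integral_wedge_offsets_le[OF k])
  finally have "epowr (\<integral>\<^sup>+ x. epowr (ennreal \<bar>V x\<bar>) (enn2real p) \<partial>lebesgue_on {a..b}) (1 / enn2real p)
      \<le> epowr (ennreal (R * norm (w - v)) * (\<integral>\<^sup>+ u. k u \<partial>lborel)) (1 / enn2real p)"
    by (intro epowr_mono) auto
  then show ?thesis using p by (simp add: Lp_norm_def eLp_norm_def)
qed


text \<open>On a bounded set \<open>\<bar>y\<bar> \<le> 1 + \<bar>y\<bar>\<^bsup>q\<^esup>\<close> makes an \<open>L\<^sup>q\<close> function integrable.\<close>

lemma Lp_imp_integrable:
  fixes G :: "'a :: euclidean_space \<Rightarrow> real"
  assumes G [measurable]: "G \<in> borel_measurable borel" and supp: "\<forall>u. u \<notin> cball 0 R \<longrightarrow> G u = 0"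
    and q: "1 \<le> q" and fin: "(\<integral>\<^sup>+ u. ennreal (\<bar>G u\<bar> powr q) \<partial>lborel) < \<infinity>"
  shows "integrable lborel G"
proof (rule integrableI_bounded)
  have [measurable]: "cball (0::'a) R \<in> sets borel" by (simp add: borel_closed)
  have "(\<integral>\<^sup>+ u. norm (G u) \<partial>lborel)
      \<le> (\<integral>\<^sup>+ u. indicator (cball 0 R) u + ennreal (\<bar>G u\<bar> powr q) \<partial>lborel)"
  proof (rule nn_integral_mono)
    fix u
    show "ennreal (norm (G u)) \<le> indicator (cball 0 R) u + ennreal (\<bar>G u\<bar> powr q)"
    proof (cases "u \<in> cball 0 R")
      case True
      have "\<bar>G u\<bar> \<le> 1 + \<bar>G u\<bar> powr q"
        using powr_mono[of 1 q "\<bar>G u\<bar>"] q by (cases "\<bar>G u\<bar> \<le> 1") (auto simp: add_increasing2)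
      then have "ennreal \<bar>G u\<bar> \<le> ennreal (1 + \<bar>G u\<bar> powr q)"
        by (rule ennreal_leI)
      also have "\<dots> = 1 + ennreal (\<bar>G u\<bar> powr q)" by simp
      finally show ?thesis using True by simp
    qed (use supp in auto)
  qed
  also have "\<dots> = emeasure lborel (cball (0::'a) R) + (\<integral>\<^sup>+ u. ennreal (\<bar>G u\<bar> powr q) \<partial>lborel)"
    by (subst nn_integral_add) simp_all
  also have "\<dots> < \<infinity>"
    using fin emeasure_bounded_finite[OF bounded_cball, of "0::'a" R] by (simp add: less_top)
  finally show "(\<integral>\<^sup>+ u. norm (G u) \<partial>lborel) < \<infinity>" .
qed simp

text \<open>
  For a finite exponent \<open>q\<close>, \<open>\<bar>V x\<bar>\<close> is at most the mass \<open>H x\<close> of \<open>\<bar>G\<bar>\<close> in the wedge at offset \<open>x\<close>.  The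
  two estimates differ in how \<open>\<bar>V x\<bar>\<^bsup>q\<^esup>\<close> is bounded by the mass of another density in the wedge:
  Hoelder gives \<open>(\<delta> R\<^sup>2)\<^bsup>q-1\<^esup>\<close> times that of \<open>\<bar>G\<bar>\<^bsup>q\<^esup>\<close>, while \<open>\<bar>V x\<bar> \<le> \<parallel>G\<parallel>\<^sub>1\<close> gives
  \<open>\<parallel>G\<parallel>\<^sub>1\<^bsup>q-1\<^esup>\<close> times that of \<open>\<bar>G\<bar>\<close>.
\<close>

lemma half_plane_difference_Lp_bounds:
  assumes w: "norm w = 1" and R: "0 < R" and \<delta>: "0 < \<delta>" "\<delta> < pi" and p: "1 \<le> p" "p \<noteq> \<infinity>"
    and G: "integrable lborel G" and supp: "\<forall>u. u \<notin> cball 0 R \<longrightarrow> G u = 0"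
    and V: "\<And>x. V x = half_plane_integral G w x - half_plane_integral G (rot \<delta> w) x"
  shows "Lp_norm p (lebesgue_on {- R..R}) V
      \<le> ennreal ((2 * sin (\<delta> / 2)) powr recip p)
        * (ennreal (\<delta> powr (1 - recip p)) * Lp_norm p lborel G * ennreal (R powr (2 - recip p)))"
      (is "_ \<le> ?hoelder")
    and "Lp_norm p (lebesgue_on {- R..R}) V
      \<le> ennreal ((2 * sin (\<delta> / 2)) powr recip p) * (Lp_norm 1 lborel G * ennreal (R powr recip p))"
      (is "_ \<le> ?interpolation")
proof -
  define q where "q = enn2real p"
  have q: "1 \<le> q" using p enn2real_mono[of 1 p] by (simp add: q_def less_top)
  have recip: "recip p = 1 / q"
  proof -
    have "p = ennreal q" using p by (simp add: q_def less_top)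
    then show ?thesis using q by (simp add: recip_def inverse_ennreal inverse_eq_divide)
  qed
  have G' [measurable]: "G \<in> borel_measurable borel" using G by auto
  define s where "s = 2 * sin (\<delta> / 2)"
  have s: "0 < s" using \<delta> by (auto simp: s_def intro!: sin_gt_zero)
  have n: "norm (w - rot \<delta> w) = s" using norm_rot_diff[OF w, of \<delta>] \<delta> by (simp add: s_def)
  let ?W = "wedge R w (rot \<delta> w)"
  let ?H = "\<lambda>x. \<integral>\<^sup>+ u. ennreal \<bar>G u\<bar> * indicator (?W x) u \<partial>lborel"
  have V_le: "ennreal \<bar>V x\<bar> \<le> ?H x" for x
    unfolding V by (rule half_plane_integral_diff_le[OF G supp])
  have W: "emeasure lborel (?W x) \<le> ennreal (\<delta> * R\<^sup>2)" for x
    using emeasure_wedge_le[OF w] \<delta> R by simp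
  have dR: "0 < \<delta> * R\<^sup>2" using \<delta> R by simp

  let ?J = "\<integral>\<^sup>+ u. ennreal (\<bar>G u\<bar> powr q) \<partial>lborel"
  have Lp: "Lp_norm p lborel G = epowr ?J (1 / q)"
    using p by (simp add: Lp_norm_def eLp_norm_def q_def epowr_ennreal)
  show "Lp_norm p (lebesgue_on {- R..R}) V \<le> ?hoelder"
  proof (cases ?J)
    case top
    have "?hoelder = \<infinity>"
      unfolding Lp top using s \<delta> R
      by (simp add: epowr_def s_def[symmetric] ennreal_mult_top ennreal_top_mult)
    then show ?thesis by simp
  next
    case (real J)
    let ?k = "\<lambda>u. ennreal ((\<delta> * R\<^sup>2) powr (q - 1)) * ennreal (\<bar>G u\<bar> powr q)"
    have le: "Lp_norm p (lebesgue_on {- R..R}) V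
        \<le> epowr (ennreal (R * norm (w - rot \<delta> w)) * (\<integral>\<^sup>+ u. ?k u \<partial>lborel)) (1 / enn2real p)"
    proof (rule Lp_norm_interval_le[OF p])
      fix x
      have "ennreal (\<bar>V x\<bar> powr q) = epowr (ennreal \<bar>V x\<bar>) q" by (simp add: epowr_ennreal)
      also have "\<dots> \<le> epowr (?H x) q" using V_le q by (intro epowr_mono) auto
      also have "\<dots> \<le> ennreal ((\<delta> * R\<^sup>2) powr (q - 1))
          * (\<integral>\<^sup>+ u. ennreal (\<bar>G u\<bar> powr q) * indicator (?W x) u \<partial>lborel)"
        by (rule Hoelder_indicator[OF _ _ _ W dR q]) simp_all
      also have "\<dots> = (\<integral>\<^sup>+ u. ?k u * indicator (?W x) u \<partial>lborel)"
        by (subst nn_integral_cmult[symmetric]) (simp_all add: mult.assoc)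
      finally show "ennreal (\<bar>V x\<bar> powr enn2real p) \<le> (\<integral>\<^sup>+ u. ?k u * indicator (?W x) u \<partial>lborel)"
        by (simp add: q_def)
    qed simp
    also have "(\<integral>\<^sup>+ u. ?k u \<partial>lborel) = ennreal ((\<delta> * R\<^sup>2) powr (q - 1) * J)"
      using real by (simp add: nn_integral_cmult ennreal_mult)
    also have "epowr (ennreal (R * norm (w - rot \<delta> w)) * \<dots>) (1 / enn2real p)
        = ennreal ((R * s * ((\<delta> * R\<^sup>2) powr (q - 1) * J)) powr (1 / q))"
      unfolding n using R s real by (simp add: ennreal_mult[symmetric] epowr_ennreal q_def)
    also have "(R * s * ((\<delta> * R\<^sup>2) powr (q - 1) * J)) powr (1 / q)
        = s powr (1 / q) * (\<delta> powr (1 - 1 / q) * J powr (1 / q) * R powr (2 - 1 / q))"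
    proof -
      have e: "(q - 1) * (1 / q) = 1 - 1 / q" using q by (simp add: field_simps)
      have "(\<delta> * R\<^sup>2) powr (1 - 1 / q) = \<delta> powr (1 - 1 / q) * R powr (2 * (1 - 1 / q))"
        using R \<delta> by (simp only: powr_mult powr_powr less_imp_le zero_le_power2 powr_numeral[symmetric])
      moreover have "R powr (1 / q) * R powr (2 * (1 - 1 / q)) = R powr (2 - 1 / q)"
        by (simp add: powr_add[symmetric] algebra_simps)
      moreover have "(R * s * (M powr (q - 1) * J)) powr (1 / q)
          = R powr (1 / q) * s powr (1 / q) * (M powr (1 - 1 / q) * J powr (1 / q))" if "0 \<le> M" for M
        using that R s real(1) by (simp only: powr_mult powr_powr e mult_nonneg_nonneg powr_ge_zero less_imp_le)
      ultimately show ?thesis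
        using dR by (simp add: mult_ac)
    qed
    also have "ennreal \<dots> = ?hoelder"
      unfolding Lp real(2) recip s_def[symmetric] using real(1) s R \<delta>
      by (simp add: epowr_ennreal ennreal_mult)
    finally show ?thesis .
  qed

  have "(\<integral>\<^sup>+ u. ennreal \<bar>G u\<bar> \<partial>lborel) < \<infinity>"
    using G by (simp add: integrable_iff_bounded)
  then obtain N where N: "0 \<le> N" "(\<integral>\<^sup>+ u. ennreal \<bar>G u\<bar> \<partial>lborel) = ennreal N"
    by (cases "\<integral>\<^sup>+ u. ennreal \<bar>G u\<bar> \<partial>lborel") auto
  have L1: "Lp_norm 1 lborel G = ennreal N"
    using N by (simp add: Lp_norm_def eLp_norm_def epowr_ennreal)
  let ?k = "\<lambda>u. ennreal (N powr (q - 1)) * ennreal \<bar>G u\<bar>"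
  have "Lp_norm p (lebesgue_on {- R..R}) V
      \<le> epowr (ennreal (R * norm (w - rot \<delta> w)) * (\<integral>\<^sup>+ u. ?k u \<partial>lborel)) (1 / enn2real p)"
  proof (rule Lp_norm_interval_le[OF p])
    fix x
    have "?H x \<le> (\<integral>\<^sup>+ u. ennreal \<bar>G u\<bar> \<partial>lborel)"
      by (intro nn_integral_mono) (auto simp: indicator_def)
    with V_le[of x] have "ennreal \<bar>V x\<bar> \<le> ennreal N" unfolding N(2) by (rule order_trans)
    then have VN: "\<bar>V x\<bar> \<le> N" using N by (simp add: ennreal_le_iff)
    have "\<bar>V x\<bar> powr q = \<bar>V x\<bar> powr (q - 1) * \<bar>V x\<bar>"
      by (cases "V x = 0") (simp_all add: powr_diff)
    also have "\<dots> \<le> N powr (q - 1) * \<bar>V x\<bar>"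
      using VN q by (intro mult_right_mono powr_mono2) auto
    finally have "ennreal (\<bar>V x\<bar> powr q) \<le> ennreal (N powr (q - 1)) * ennreal \<bar>V x\<bar>"
      by (simp add: ennreal_mult[symmetric] ennreal_leI)
    also have "\<dots> \<le> ennreal (N powr (q - 1)) * ?H x"
      by (intro mult_left_mono V_le) simp
    also have "\<dots> = (\<integral>\<^sup>+ u. ?k u * indicator (?W x) u \<partial>lborel)"
      by (subst nn_integral_cmult[symmetric]) (simp_all add: mult.assoc)
    finally show "ennreal (\<bar>V x\<bar> powr enn2real p) \<le> (\<integral>\<^sup>+ u. ?k u * indicator (?W x) u \<partial>lborel)"
      by (simp add: q_def)
  qed simp
  also have "(\<integral>\<^sup>+ u. ?k u \<partial>lborel) = ennreal (N powr (q - 1) * N)"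
    using N by (simp add: nn_integral_cmult ennreal_mult)
  also have "N powr (q - 1) * N = N powr q"
    by (cases "N = 0") (use N in \<open>simp_all add: powr_diff\<close>)
  also have "epowr (ennreal (R * norm (w - rot \<delta> w)) * ennreal (N powr q)) (1 / enn2real p)
      = ennreal ((R * s * N powr q) powr (1 / q))"
    unfolding n using R s by (simp add: ennreal_mult[symmetric] epowr_ennreal q_def)
  also have "(R * s * N powr q) powr (1 / q) = s powr (1 / q) * (N * R powr (1 / q))"
    using R s N q by (simp add: powr_mult powr_powr)
  also have "ennreal \<dots> = ?interpolation"
    unfolding L1 recip s_def[symmetric] using N by (simp add: ennreal_mult)
  finally show "Lp_norm p (lebesgue_on {- R..R}) V \<le> ?interpolation" .
qed

lemma half_plane_difference_sup_bounds:
  assumes w: "norm w = 1" and R: "0 \<le> R" and \<delta>: "0 \<le> \<delta>"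
    and G: "integrable lborel G" and supp: "\<forall>u. u \<notin> cball 0 R \<longrightarrow> G u = 0"
  shows "ennreal \<bar>half_plane_integral G w x - half_plane_integral G (rot \<delta> w) x\<bar>
      \<le> ennreal (\<delta> * R\<^sup>2) * esssup lborel (\<lambda>u. ennreal \<bar>G u\<bar>)"
    and "ennreal \<bar>half_plane_integral G w x - half_plane_integral G (rot \<delta> w) x\<bar>
      \<le> (\<integral>\<^sup>+ u. ennreal \<bar>G u\<bar> \<partial>lborel)"
proof -
  let ?W = "wedge R w (rot \<delta> w) x" and ?S = "esssup lborel (\<lambda>u. ennreal \<bar>G u\<bar>)"
  have V: "ennreal \<bar>half_plane_integral G w x - half_plane_integral G (rot \<delta> w) x\<bar>
      \<le> (\<integral>\<^sup>+ u. ennreal \<bar>G u\<bar> * indicator ?W u \<partial>lborel)"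
    by (rule half_plane_integral_diff_le[OF G supp])
  also have "\<dots> \<le> (\<integral>\<^sup>+ u. ?S * indicator ?W u \<partial>lborel)"
  proof (rule nn_integral_mono_AE)
    show "AE u in lborel. ennreal \<bar>G u\<bar> * indicator ?W u \<le> ?S * indicator ?W u"
      using esssup_AE[of "\<lambda>u. ennreal \<bar>G u\<bar>" lborel] by eventually_elim (rule mult_right_mono, auto)
  qed
  also have "\<dots> = ?S * emeasure lborel ?W"
    by (simp add: nn_integral_cmult)
  also have "\<dots> \<le> ?S * ennreal (\<delta> * R\<^sup>2)"
    using emeasure_wedge_le[OF w \<delta> R] by (rule mult_left_mono) simp
  finally show "ennreal \<bar>half_plane_integral G w x - half_plane_integral G (rot \<delta> w) x\<bar>
      \<le> ennreal (\<delta> * R\<^sup>2) * ?S" by (simp add: mult.commute)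
  note V
  also have "(\<integral>\<^sup>+ u. ennreal \<bar>G u\<bar> * indicator ?W u \<partial>lborel) \<le> (\<integral>\<^sup>+ u. ennreal \<bar>G u\<bar> \<partial>lborel)"
    by (intro nn_integral_mono) (auto simp: indicator_def)
  finally show "ennreal \<bar>half_plane_integral G w x - half_plane_integral G (rot \<delta> w) x\<bar>
      \<le> (\<integral>\<^sup>+ u. ennreal \<bar>G u\<bar> \<partial>lborel)" .
qed

section \<open>The sliced Volterra distance to a rotated function\<close>

theorem theorem4p5:
  fixes p :: ennreal and R \<delta> :: real
    and F :: "real \<times> real \<Rightarrow> real"
    and \<eta> :: "(real \<times> real) measure"
  assumes "1 \<le> p" and "0 < R"
    and "in_Lp p lebesgue F"
    and "AE u in lebesgue. u \<notin> cball 0 R \<longrightarrow> F u = 0"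
    and "0 \<le> \<delta>" and "\<delta> < pi"
    and "prob_space \<eta>"
    and "sets \<eta> = sets (restrict_space borel (sphere (0 :: real \<times> real) 1))"
  shows "sliced_volterra p \<eta> R F (rotated \<delta> F)
    \<le> ennreal ((2 * sin (\<delta> / 2)) powr recip p)
      * min (ennreal (\<delta> powr (1 - recip p)) * Lp_norm p lebesgue F * ennreal (R powr (2 - recip p)))
            (Lp_norm 1 lebesgue F * ennreal (R powr recip p))"
    (is "_ \<le> ?K")
proof (cases "\<delta> = 0")
  case True
  \<comment> \<open>\<open>0 powr 0 = 0\<close>, so for \<open>p = \<infinity>\<close> the right-hand side is \<open>0\<close> here: the distance has to vanish.\<close>
  then have "rotated \<delta> F = F" by (auto simp: rotated_def)
  then have "sliced_volterra p \<eta> R F (rotated \<delta> F) = 0"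
    by (simp add: sliced_volterra_def volterra_norm_def Lp_norm_def volterra_def set_lebesgue_integral_def eLp_norm_zero)
  then show ?thesis by simp
next
  case False
  with \<open>0 \<le> \<delta>\<close> have \<delta>: "0 < \<delta>" by simp
  have "F \<in> borel_measurable lebesgue" and fin: "Lp_norm p lebesgue F < \<infinity>"
    using assms(3) by (auto simp: in_Lp_def)
  then obtain g where [measurable]: "g \<in> borel_measurable borel" and g: "AE u in lborel. F u = g u"
    using completion_ex_borel_measurable_real[of F lborel] by auto
  \<comment> \<open>A Borel representative that vanishes everywhere, not just almost everywhere, off the disc.\<close>
  define G where "G u = indicator (cball 0 R) u * g u" for u
  have [measurable]: "cball (0 :: real \<times> real) R \<in> sets borel" by (simp add: borel_closed)
  have G_borel [measurable]: "G \<in> borel_measurable borel" unfolding G_def by measurable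
  have supp: "\<forall>u. u \<notin> cball 0 R \<longrightarrow> G u = 0" by (simp add: G_def)
  have ae: "AE u in lborel. F u = G u"
    using assms(4)[unfolded AE_completion_iff] g by eventually_elim (auto simp: G_def indicator_def)
  note norm_eq = Lp_norm_lebesgue_cong[OF G_borel ae]

  have G: "integrable lborel G"
  proof (cases "p = \<infinity>")
    case True
    let ?S = "esssup lborel (\<lambda>u. ennreal \<bar>G u\<bar>)"
    have "?S < \<infinity>" using fin[unfolded norm_eq] True by (simp add: Lp_norm_def eLp_norm_def)
    have "(\<integral>\<^sup>+ u. norm (G u) \<partial>lborel) \<le> (\<integral>\<^sup>+ u. ?S * indicator (cball (0 :: real \<times> real) R) u \<partial>lborel)"
    proof (rule nn_integral_mono_AE)
      show "AE u in lborel. ennreal (norm (G u)) \<le> ?S * indicator (cball 0 R) u"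
        using esssup_AE[of "\<lambda>u. ennreal \<bar>G u\<bar>" lborel]
        by eventually_elim (use supp in \<open>auto simp: indicator_def\<close>)
    qed
    also have "\<dots> = ?S * emeasure lborel (cball (0 :: real \<times> real) R)"
      by (rule nn_integral_cmult_indicator) simp
    also have "\<dots> < \<infinity>"
      using \<open>?S < \<infinity>\<close> emeasure_bounded_finite[OF bounded_cball, of "0 :: real \<times> real" R]
      by (simp add: ennreal_mult_less_top)
    finally show ?thesis by (intro integrableI_bounded) simp_all
  next
    case False
    define q where "q = enn2real p"
    have q: "1 \<le> q" using assms(1) False enn2real_mono[of 1 p] by (simp add: q_def less_top)
    have "epowr (\<integral>\<^sup>+ u. ennreal (\<bar>G u\<bar> powr q) \<partial>lborel) (1 / q) < \<infinity>"
      using fin[unfolded norm_eq] False by (simp add: Lp_norm_def eLp_norm_def q_def epowr_ennreal)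
    then have "(\<integral>\<^sup>+ u. ennreal (\<bar>G u\<bar> powr q) \<partial>lborel) < \<infinity>"
      by (auto simp: epowr_def less_top split: if_splits)
    then show ?thesis by (rule Lp_imp_integrable[OF G_borel supp q])
  qed

  define V where "V w x = half_plane_integral G w x - half_plane_integral G (rot \<delta> w) x" for w x
  have V_eq: "volterra (- R) (\<lambda>t. proj w F t - proj w (rotated \<delta> F) t) = V w"
    and V_cont: "continuous_on {- R..R} (V w)" if "norm w = 1" for w
  proof -
    show eq: "volterra (- R) (\<lambda>t. proj w F t - proj w (rotated \<delta> F) t) = V w"
      unfolding V_def by (rule ext, rule volterra_sliced_difference(1)[OF that G ae supp])
    show "continuous_on {- R..R} (V w)"
      using volterra_sliced_difference(2)[OF that G ae supp, of \<delta>] unfolding eq .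
  qed
  let ?f = "\<lambda>w. volterra_norm p (- R) R (\<lambda>t. proj w F t - proj w (rotated \<delta> F) t)"
  have f_eq: "?f w = Lp_norm p (lebesgue_on {- R..R}) (V w)" if "norm w = 1" for w
    unfolding volterra_norm_def V_eq[OF that] ..
  have "space \<eta> = space (restrict_space borel (sphere (0 :: real \<times> real) 1))"
    by (rule sets_eq_imp_space_eq[OF assms(8)])
  then have sphere: "w \<in> space \<eta> \<Longrightarrow> norm w = 1" for w
    by (simp add: space_restrict_space)

  have "?f w \<le> ?K" if w: "norm w = 1" for w
  proof -
    let ?c = "ennreal ((2 * sin (\<delta> / 2)) powr recip p)"
    let ?a = "ennreal (\<delta> powr (1 - recip p)) * Lp_norm p lborel G * ennreal (R powr (2 - recip p))"
    let ?b = "Lp_norm 1 lborel G * ennreal (R powr recip p)"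
    have "Lp_norm p (lebesgue_on {- R..R}) (V w) \<le> ?c * ?a \<and> Lp_norm p (lebesgue_on {- R..R}) (V w) \<le> ?c * ?b"
    proof (cases "p = \<infinity>")
      case True
      have "0 < sin (\<delta> / 2)" using \<delta> assms(6) by (intro sin_gt_zero) auto
      then have c: "?c = 1" using True by (simp add: recip_def)
      have a: "?a = ennreal (\<delta> * R\<^sup>2) * esssup lborel (\<lambda>u. ennreal \<bar>G u\<bar>)"
        using True \<delta> \<open>0 < R\<close> by (simp add: recip_def Lp_norm_def eLp_norm_def ennreal_mult mult_ac)
      have b: "?b = (\<integral>\<^sup>+ u. ennreal \<bar>G u\<bar> \<partial>lborel)"
        using True \<open>0 < R\<close> by (simp add: recip_def Lp_norm_def eLp_norm_def epowr_def less_top)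
      have "V w \<in> borel_measurable (lebesgue_on {- R..R})"
        using continuous_imp_measurable_on_sets_lebesgue[OF V_cont[OF w]] by simp
      then have m: "(\<lambda>x. ennreal \<bar>V w x\<bar>) \<in> borel_measurable (lebesgue_on {- R..R})"
        by simp
      show ?thesis
        unfolding c a b using True half_plane_difference_sup_bounds[OF w _ \<open>0 \<le> \<delta>\<close> G supp] \<open>0 < R\<close>
        by (auto simp: Lp_norm_def eLp_norm_def V_def[symmetric] intro!: esssup_I[OF m])
    next
      case False
      show ?thesis
        using half_plane_difference_Lp_bounds[OF w assms(2) \<delta> assms(6,1) False G supp V_def] by blast
    qed
    then show ?thesis
      unfolding f_eq[OF w] norm_eq by (simp add: min_def)
  qed
  moreover have "?f \<in> borel_measurable \<eta>" if "p = \<infinity>"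
  proof -
    have [measurable]: "rot \<delta> \<in> borel_measurable borel"
      unfolding rot_def by (intro borel_measurable_continuous_onI continuous_intros)
    note [measurable] = borel_measurable_half_plane_integral[OF G_borel]
    have "(\<lambda>w. SUP x\<in>{- R..R} \<inter> \<rat>. ennreal \<bar>V w x\<bar>) \<in> borel_measurable borel"
      unfolding V_def by (intro borel_measurable_SUP countable_Int2 countable_rat) measurable
    then have "(\<lambda>w. SUP x\<in>{- R..R} \<inter> \<rat>. ennreal \<bar>V w x\<bar>) \<in> borel_measurable \<eta>"
      unfolding measurable_cong_sets[OF assms(8) refl] by (rule measurable_restrict_space1)
    moreover have "?f w = (SUP x\<in>{- R..R} \<inter> \<rat>. ennreal \<bar>V w x\<bar>)" if "w \<in> space \<eta>" for w
    proof -
      have "continuous_on {- R..R} (\<lambda>x. \<bar>V w x\<bar>)"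
        using V_cont[OF sphere[OF that]] by (intro continuous_intros)
      then show ?thesis
        unfolding f_eq[OF sphere[OF that]] using \<open>p = \<infinity>\<close> \<open>0 < R\<close>
        by (simp add: Lp_norm_def eLp_norm_def esssup_continuous_eq_SUP)
    qed
    ultimately show ?thesis by (simp cong: measurable_cong)
  qed
  ultimately show ?thesis
    unfolding sliced_volterra_def
    by (intro eLp_norm_le_of_bounded[OF assms(7,1)]) (auto dest: sphere)
qed

end
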